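(* Let $\Gamma$ be a discrete group, $\mathcal{G}$ a $\Gamma$-graded ample Hausdorff groupoid with grading cocycle $c:\mathcal{G}\to\Gamma$, $R$ a commutative ring with identity $1\neq 0$ and $A_R(\mathcal{G})$ the Steinberg algebra associated to $\mathcal{G}$. The following statements are equivalent: (i) for every $\Gamma$-aperiodic invariant subset $W\subseteq\mathcal{G}^{(0)}$ with closure $W^-$ in $\mathcal{G}^{(0)}$, the groupoid $(c|_{\mathcal{G}_{W^-}})^{-1}(\varepsilon)$ is effective; (ii) for every $\Gamma$-aperiodic invariant subset $W\subseteq\mathcal{G}^{(0)}$, $$\mathrm{Ann}_{A_R(\mathcal{G})}(RW)=A_R(\mathcal{G}_U),$$ where $U=(\mathcal{G}^{(0)}\setminus W)^\circ$ is the interior of the invariant subset $\mathcal{G}^{(0)}\setminus W$ in $\mathcal G^{(0)}$.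
   Context: For $x$ in a groupoid $\mathcal{G}$, $d(x)=x^{-1}x$, $r(x)=xx^{-1}$; $\mathcal{G}^{(0)}$ is the unit space. A compact open bisection is a compact open $B\subseteq\mathcal{G}$ on which $d$ and $r$ are homeomorphisms onto open subsets of $\mathcal{G}^{(0)}$. $\mathcal{G}$ is ample if it is a topological groupoid whose domain map is a local homeomorphism and which has a basis of compact open bisections. A $\Gamma$-grading is a continuous $c:\mathcal{G}\to\Gamma$ with $c(xy)=c(x)c(y)$ for composable $x,y$; $\varepsilon$ is the identity of $\Gamma$. $A_R(\mathcal{G})$ is the $R$-span of characteristic functions $1_B:\mathcal{G}\to R$ of compact open bisections, with convolution $(f*g)(z)=\sum_{xy=z}f(x)g(y)$. $W\subseteq\mathcal{G}^{(0)}$ is invariant if $d(x)\in W$ implies $r(x)\in W$; interiors, closures and complements of invariant sets are invariant. For $W$ invariant, $\mathcal{G}_W=d^{-1}(W)=\{x:d(x),r(x)\in W\}$, a groupoid with unit space $W$ and the subspace topology. If $U$ is open and invariant, $\mathcal{G}_U$ is open in $\mathcal{G}$ and $A_R(\mathcal{G}_U)$ is viewed inside $A_R(\mathcal{G})$ by extending functions by $0$. $\mathrm{Iso}(u)=\{x:d(x)=r(x)=u\}$; a unit $u$ is $\Gamma$-aperiodic if $\mathrm{Iso}(u)\subseteq c^{-1}(\varepsilon)$; an invariant set is $\Gamma$-aperiodic if all its elements are. For $W$ invariant, $RW$ is the free $R$-module with basis $W$, a left $A_R(\mathcal{G})$-module via: for a compact open bisection $B$ and $u\in W$, $1_B\cdot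 u=r(b)$ if $b\in B$ has $d(b)=u$, and $1_B\cdot u=0$ if $u\notin d(B)$. $\mathrm{Ann}_{A_R(\mathcal{G})}(RW)=\{f: f\cdot m=0\ \forall m\in RW\}$. An ample Hausdorff groupoid $\mathcal{H}$ is effective if the interior in $\mathcal{H}$ of $\bigsqcup_{u\in\mathcal{H}^{(0)}}\mathrm{Iso}(u)$ equals $\mathcal{H}^{(0)}$. *)

theory Defs
  imports "HOL-Analysis.Analysis" "HOL-Library.Function_Algebras" "HOL-Library.Groups_Big_Fun"
begin

(* The set of arrows of a groupoid is the topspace of its topology; the values of gmult on
   non-composable pairs and of gmult, ginv outside that set are irrelevant. *)
record 'g tgroupoid =
  gtop :: "'g topology"
  gmult :: "'g \<Rightarrow> 'g \<Rightarrow> 'g"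
  ginv :: "'g \<Rightarrow> 'g"

definition arrows :: "'g tgroupoid \<Rightarrow> 'g set"
  where "arrows G = topspace (gtop G)"

definition gdom :: "'g tgroupoid \<Rightarrow> 'g \<Rightarrow> 'g"
  where "gdom G x = gmult G (ginv G x) x"

definition gran :: "'g tgroupoid \<Rightarrow> 'g \<Rightarrow> 'g"
  where "gran G x = gmult G x (ginv G x)"

definition composable :: "'g tgroupoid \<Rightarrow> ('g \<times> 'g) set"
  where "composable G = {(x, y). x \<in> arrows G \<and> y \<in> arrows G \<and> gdom G x = gran G y}"

definition units :: "'g tgroupoid \<Rightarrow> 'g set"
  where "units G = gdom G ` arrows G"

definition unit_top :: "'g tgroupoid \<Rightarrow> 'g topology"
  where "unit_top G = subtopology (gtop G) (units G)"

(* A small category all of whose arrows are invertible, objects being identified with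
   their identity arrows. *)
locale groupoid =
  fixes G :: "'g tgroupoid"
  assumes mult_closed: "(x, y) \<in> composable G \<Longrightarrow> gmult G x y \<in> arrows G"
    and dom_mult: "(x, y) \<in> composable G \<Longrightarrow> gdom G (gmult G x y) = gdom G y"
    and ran_mult: "(x, y) \<in> composable G \<Longrightarrow> gran G (gmult G x y) = gran G x"
    and assoc: "(x, y) \<in> composable G \<Longrightarrow> (y, z) \<in> composable G \<Longrightarrow>
      gmult G (gmult G x y) z = gmult G x (gmult G y z)"
    and inv_closed: "x \<in> arrows G \<Longrightarrow> ginv G x \<in> arrows G"
    and dom_inv: "x \<in> arrows G \<Longrightarrow> gdom G (ginv G x) = gran G x"
    and ran_inv: "x \<in> arrows G \<Longrightarrow> gran G (ginv G x) = gdom G x"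
    and mult_dom: "x \<in> arrows G \<Longrightarrow> gmult G x (gdom G x) = x"
    and ran_mult_self: "x \<in> arrows G \<Longrightarrow> gmult G (gran G x) x = x"

locale topological_groupoid = groupoid +
  assumes continuous_mult:
      "continuous_map (subtopology (prod_topology (gtop G) (gtop G)) (composable G)) (gtop G)
        (\<lambda>(x, y). gmult G x y)"
    and continuous_inv: "continuous_map (gtop G) (gtop G) (ginv G)"

definition local_homeomorphism_map :: "'a topology \<Rightarrow> 'b topology \<Rightarrow> ('a \<Rightarrow> 'b) \<Rightarrow> bool"
  where "local_homeomorphism_map X Y f \<longleftrightarrow> (\<forall>x\<in>topspace X. \<exists>V. openin X V \<and> x \<in> V \<and>
    openin Y (f ` V) \<and> homeomorphic_map (subtopology X V) (subtopology Y (f ` V)) f)"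

definition compact_open_bisection :: "'g tgroupoid \<Rightarrow> 'g set \<Rightarrow> bool"
  where "compact_open_bisection G B \<longleftrightarrow> compactin (gtop G) B \<and> openin (gtop G) B \<and>
    openin (unit_top G) (gdom G ` B) \<and>
    homeomorphic_map (subtopology (gtop G) B) (subtopology (unit_top G) (gdom G ` B)) (gdom G) \<and>
    openin (unit_top G) (gran G ` B) \<and>
    homeomorphic_map (subtopology (gtop G) B) (subtopology (unit_top G) (gran G ` B)) (gran G)"

locale ample_groupoid = topological_groupoid +
  assumes dom_local_homeomorphism: "local_homeomorphism_map (gtop G) (unit_top G) (gdom G)"
    and bisection_basis: "openin (gtop G) V \<Longrightarrow> x \<in> V \<Longrightarrow>
      \<exists>B. compact_open_bisection G B \<and> x \<in> B \<and> B \<subseteq> V"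

(* The grading group is a type of class group_add: an arbitrary, not necessarily commutative,
   group written additively, with identity 0. *)
definition grading :: "'g tgroupoid \<Rightarrow> ('g \<Rightarrow> 'c::group_add) \<Rightarrow> bool"
  where "grading G c \<longleftrightarrow> continuous_map (gtop G) (discrete_topology UNIV) c \<and>
    (\<forall>(x, y)\<in>composable G. c (gmult G x y) = c x + c y)"

definition invariant :: "'g tgroupoid \<Rightarrow> 'g set \<Rightarrow> bool"
  where "invariant G W \<longleftrightarrow> W \<subseteq> units G \<and> (\<forall>x\<in>arrows G. gdom G x \<in> W \<longrightarrow> gran G x \<in> W)"

definition subgroupoid :: "'g tgroupoid \<Rightarrow> 'g set \<Rightarrow> 'g tgroupoid"
  where "subgroupoid G H = G\<lparr>gtop := subtopology (gtop G) H\<rparr>"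

definition reduction :: "'g tgroupoid \<Rightarrow> 'g set \<Rightarrow> 'g tgroupoid"
  where "reduction G W = subgroupoid G {x \<in> arrows G. gdom G x \<in> W}"

definition grading_kernel :: "'g tgroupoid \<Rightarrow> ('g \<Rightarrow> 'c::group_add) \<Rightarrow> 'g tgroupoid"
  where "grading_kernel G c = subgroupoid G {x \<in> arrows G. c x = 0}"

definition Iso :: "'g tgroupoid \<Rightarrow> 'g \<Rightarrow> 'g set"
  where "Iso G u = {x \<in> arrows G. gdom G x = u \<and> gran G x = u}"

definition effective :: "'g tgroupoid \<Rightarrow> bool"
  where "effective G \<longleftrightarrow> gtop G interior_of (\<Union>u\<in>units G. Iso G u) = units G"

definition aperiodic_unit :: "'g tgroupoid \<Rightarrow> ('g \<Rightarrow> 'c::group_add) \<Rightarrow> 'g \<Rightarrow> bool"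
  where "aperiodic_unit G c u \<longleftrightarrow> Iso G u \<subseteq> {x \<in> arrows G. c x = 0}"

definition aperiodic :: "'g tgroupoid \<Rightarrow> ('g \<Rightarrow> 'c::group_add) \<Rightarrow> 'g set \<Rightarrow> bool"
  where "aperiodic G c W \<longleftrightarrow> (\<forall>u\<in>W. aperiodic_unit G c u)"

definition fscale :: "'r::comm_ring_1 \<Rightarrow> ('g \<Rightarrow> 'r) \<Rightarrow> 'g \<Rightarrow> 'r"
  where "fscale a f = (\<lambda>x. a * f x)"

lemma module_fscale: "module fscale"
  by unfold_locales (auto simp: fscale_def fun_eq_iff algebra_simps)

(* Elements of the Steinberg algebra are total functions on 'g that vanish off the arrows of the
   groupoid.  Hence extension by zero from an open subgroupoid is the identity map, and
   steinberg (reduction G U) is literally a subset of steinberg G for U open invariant. *)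
definition steinberg :: "'g tgroupoid \<Rightarrow> ('g \<Rightarrow> 'r::comm_ring_1) set"
  where "steinberg G = module.span fscale {indicator B | B. compact_open_bisection G B}"

(* The free module on W: finitely supported functions, u in W being identified with the
   function indicator {u}. *)
definition free_module_on :: "'g set \<Rightarrow> ('g \<Rightarrow> 'r::comm_ring_1) set"
  where "free_module_on W = {m. finite {u. m u \<noteq> 0} \<and> {u. m u \<noteq> 0} \<subseteq> W}"

(* The R-bilinear map determined by 1_B . u = r(b) if b in B, d(b) = u, and 1_B . u = 0 if u is
   not in d(B); the first clause only normalises its values outside the intended domain.
   Existence and uniqueness are proved below. *)
definition is_steinberg_action ::
    "'g tgroupoid \<Rightarrow> 'g set \<Rightarrow> (('g \<Rightarrow> 'r::comm_ring_1) \<Rightarrow> ('g \<Rightarrow> 'r) \<Rightarrow> ('g \<Rightarrow> 'r)) \<Rightarrow> bool"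
  where "is_steinberg_action G W act \<longleftrightarrow>
    (\<forall>f m. \<not> (f \<in> steinberg G \<and> m \<in> free_module_on W) \<longrightarrow> act f m = 0) \<and>
    (\<forall>f\<in>steinberg G. \<forall>m\<in>free_module_on W. act f m \<in> free_module_on W) \<and>
    (\<forall>f\<in>steinberg G. \<forall>g\<in>steinberg G. \<forall>m\<in>free_module_on W. act (f + g) m = act f m + act g m) \<and>
    (\<forall>f\<in>steinberg G. \<forall>m\<in>free_module_on W. \<forall>n\<in>free_module_on W.
      act f (m + n) = act f m + act f n) \<and>
    (\<forall>a. \<forall>f\<in>steinberg G. \<forall>m\<in>free_module_on W. act (fscale a f) m = fscale a (act f m)) \<and>
    (\<forall>a. \<forall>f\<in>steinberg G. \<forall>m\<in>free_module_on W. act f (fscale a m) = fscale a (act f m)) \<and>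
    (\<forall>B u. compact_open_bisection G B \<and> u \<in> W \<longrightarrow>
      (\<forall>b\<in>B. gdom G b = u \<longrightarrow> act (indicator B) (indicator {u}) = indicator {gran G b}) \<and>
      (u \<notin> gdom G ` B \<longrightarrow> act (indicator B) (indicator {u}) = 0))"

definition steinberg_action ::
    "'g tgroupoid \<Rightarrow> 'g set \<Rightarrow> ('g \<Rightarrow> 'r::comm_ring_1) \<Rightarrow> ('g \<Rightarrow> 'r) \<Rightarrow> ('g \<Rightarrow> 'r)"
  where "steinberg_action G W = (THE act. is_steinberg_action G W act)"

definition annihilator :: "'g tgroupoid \<Rightarrow> 'g set \<Rightarrow> ('g \<Rightarrow> 'r::comm_ring_1) set"
  where "annihilator G W =
    {f \<in> steinberg G. \<forall>m\<in>free_module_on W. steinberg_action G W f m = 0}"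

lemma compact_open_bisection_inj_on: "compact_open_bisection G B \<Longrightarrow> inj_on (gdom G) B"
  and compact_open_bisection_subset: "compact_open_bisection G B \<Longrightarrow> B \<subseteq> arrows G"
proof -
  assume B: "compact_open_bisection G B"
  then show "B \<subseteq> arrows G"
    by (auto simp: compact_open_bisection_def arrows_def dest: openin_subset)
  then have "topspace (subtopology (gtop G) B) = B" by (auto simp: arrows_def)
  with B show "inj_on (gdom G) B"
    unfolding compact_open_bisection_def using homeomorphic_imp_injective_map by metis
qed

lemma steinberg_induct [consumes 1, case_names zero add]:
  fixes f :: "'g \<Rightarrow> 'r::comm_ring_1"
  assumes "f \<in> steinberg G" "P 0"
    "\<And>a B g. compact_open_bisection G B \<Longrightarrow> g \<in> steinberg G \<Longrightarrow> P g \<Longrightarrow>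
      P (fscale a (indicator B) + g)"
  shows "P f"
proof -
  interpret module "fscale :: 'r \<Rightarrow> ('g \<Rightarrow> 'r) \<Rightarrow> _" by (rule module_fscale)
  let ?S = "{indicator B | B. compact_open_bisection G B}"
  have "f \<in> span ?S \<and> P f" using assms(1)[unfolded steinberg_def]
  proof (induction rule: span_induct_alt)
    case base
    show ?case using assms(2) span_zero by (rule conjI[rotated])
  next
    case (step a b g)
    then obtain B where B: "b = indicator B" "compact_open_bisection G B" by auto
    have "fscale a b + g \<in> span ?S"
      using step by (intro span_add[OF span_scale[OF span_base]]) auto
    moreover have "P (fscale a b + g)" unfolding B(1)
      using step by (intro assms(3)[OF B(2)]) (auto simp: steinberg_def)
    ultimately show ?case ..
  qed
  then show ?thesis ..
qed

lemma
  fixes f g :: "'g \<Rightarrow> 'r::comm_ring_1"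
  shows steinberg_indicator: "compact_open_bisection G B \<Longrightarrow> (indicator B :: 'g \<Rightarrow> 'r) \<in> steinberg G"
  and steinberg_zero: "(0 :: 'g \<Rightarrow> 'r) \<in> steinberg G"
  and steinberg_add: "f \<in> steinberg G \<Longrightarrow> g \<in> steinberg G \<Longrightarrow> f + g \<in> steinberg G"
  and steinberg_scale: "f \<in> steinberg G \<Longrightarrow> fscale a f \<in> steinberg G"
proof -
  interpret module "fscale :: 'r \<Rightarrow> ('g \<Rightarrow> 'r) \<Rightarrow> _" by (rule module_fscale)
  show "compact_open_bisection G B \<Longrightarrow> (indicator B :: 'g \<Rightarrow> 'r) \<in> steinberg G"
    unfolding steinberg_def by (intro span_base) auto
  show "(0 :: 'g \<Rightarrow> 'r) \<in> steinberg G" unfolding steinberg_def by (rule span_zero)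
  show "f \<in> steinberg G \<Longrightarrow> g \<in> steinberg G \<Longrightarrow> f + g \<in> steinberg G"
    unfolding steinberg_def by (rule span_add)
  show "f \<in> steinberg G \<Longrightarrow> fscale a f \<in> steinberg G"
    unfolding steinberg_def by (rule span_scale)
qed

lemma steinberg_zero_off: "f \<in> steinberg G \<Longrightarrow> x \<notin> arrows G \<Longrightarrow> f x = 0"
  by (induction rule: steinberg_induct)
    (auto simp: fscale_def indicator_def dest: compact_open_bisection_subset)

lemma steinberg_finite_fibre:
  "f \<in> steinberg G \<Longrightarrow> finite {x. gdom G x = u \<and> f x \<noteq> 0}"
proof (induction rule: steinberg_induct)
  case (add a B g)
  have "finite {x \<in> B. gdom G x = u}"
  proof (rule inj_on_finite)
    show "inj_on (gdom G) {x \<in> B. gdom G x = u}"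
      using compact_open_bisection_inj_on[OF add(1)] by (rule inj_on_subset) auto
    show "gdom G ` {x \<in> B. gdom G x = u} \<subseteq> {u}" by auto
  qed simp
  then have "finite ({x \<in> B. gdom G x = u} \<union> {x. gdom G x = u \<and> g x \<noteq> 0})" using add by simp
  then show ?case by (rule rev_finite_subset) (auto simp: fscale_def indicator_def)
qed simp

lemma free_module_on_add:
  assumes "m \<in> free_module_on W" "n \<in> free_module_on W"
  shows "m + n \<in> free_module_on W"
proof -
  have "{u. (m + n) u \<noteq> 0} \<subseteq> {u. m u \<noteq> 0} \<union> {u. n u \<noteq> 0}" by auto
  with assms show ?thesis unfolding free_module_on_def by (auto intro: finite_subset)
qed

lemma free_module_on_scale:
  assumes "m \<in> free_module_on W"
  shows "fscale a m \<in> free_module_on W"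
proof -
  have "{u. fscale a m u \<noteq> 0} \<subseteq> {u. m u \<noteq> 0}" by (auto simp: fscale_def)
  with assms show ?thesis unfolding free_module_on_def by (auto intro: finite_subset)
qed

lemma free_module_on_zero: "0 \<in> free_module_on W"
  and free_module_on_basis: "u \<in> W \<Longrightarrow> indicator {u} \<in> free_module_on W"
  by (auto simp: free_module_on_def indicator_def)

lemma free_module_on_induct [consumes 1, case_names zero add]:
  assumes m: "m \<in> free_module_on W" and zero: "P 0"
    and add: "\<And>a u n. u \<in> W \<Longrightarrow> n \<in> free_module_on W \<Longrightarrow> P n \<Longrightarrow>
      P (fscale a (indicator {u}) + n)"
  shows "P m"
proof -
  have "P m" if "finite S" "{u. m u \<noteq> 0} \<subseteq> S" "S \<subseteq> W" for S m
    using that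
  proof (induction S arbitrary: m)
    case empty
    then have "m = 0" by (auto simp: fun_eq_iff)
    with zero show ?case by metis
  next
    case (insert u S)
    define n where "n = m(u := 0)"
    have n: "{u. n u \<noteq> 0} \<subseteq> S" using insert.prems by (auto simp: n_def)
    have "n \<in> free_module_on W" unfolding free_module_on_def
      using n insert.prems finite_subset[OF n insert.hyps(1)] by auto
    moreover have "m = fscale (m u) (indicator {u}) + n"
      by (auto simp: fun_eq_iff n_def fscale_def)
    ultimately show ?case using add[of u n "m u"] insert.IH[OF n] insert.prems by auto
  qed
  with m show ?thesis unfolding free_module_on_def by blast
qed

definition action_formula ::
    "'g tgroupoid \<Rightarrow> ('g \<Rightarrow> 'r::comm_ring_1) \<Rightarrow> ('g \<Rightarrow> 'r) \<Rightarrow> ('g \<Rightarrow> 'r)"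
  where "action_formula G f m = (\<lambda>v. Sum_any (\<lambda>x. if gran G x = v then f x * m (gdom G x) else 0))"

lemma action_formula_finite:
  assumes "f \<in> steinberg G" "m \<in> free_module_on W"
  shows "finite {x. f x * m (gdom G x) \<noteq> 0}"
proof (rule finite_subset)
  show "{x. f x * m (gdom G x) \<noteq> 0} \<subseteq> (\<Union>u\<in>{u. m u \<noteq> 0}. {x. gdom G x = u \<and> f x \<noteq> 0})"
    by auto
  show "finite \<dots>"
    using assms steinberg_finite_fibre by (auto simp: free_module_on_def)
qed

lemma action_formula_finite':
  assumes "f \<in> steinberg G" "m \<in> free_module_on W"
  shows "finite {x. (if gran G x = v then f x * m (gdom G x) else 0) \<noteq> 0}"
  by (rule finite_subset[OF _ action_formula_finite[OF assms]]) auto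

lemma action_formula_indicator:
  assumes "compact_open_bisection G B" "b \<in> B"
  shows "action_formula G (indicator B) (indicator {gdom G b}) =
    (indicator {gran G b} :: 'g \<Rightarrow> 'r::comm_ring_1)"
proof
  fix v
  have "(\<lambda>x. if gran G x = v then indicator B x * indicator {gdom G b} (gdom G x) else 0) =
     (\<lambda>x. if x = b then (if gran G b = v then 1 else 0) else (0::'r))"
    using assms(2) inj_onD[OF compact_open_bisection_inj_on[OF assms(1)]]
    by (auto simp: fun_eq_iff indicator_def)
  then show "action_formula G (indicator B) (indicator {gdom G b}) v = (indicator {gran G b} v :: 'r)"
    unfolding action_formula_def by (simp only:) (simp add: indicator_def)
qed

lemma is_steinberg_action_formula:
  assumes inv: "invariant G W"
  shows "is_steinberg_action G W (\<lambda>f m. if f \<in> steinberg G \<and> m \<in> free_module_on W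
    then action_formula G f m else (0 :: 'g \<Rightarrow> 'r::comm_ring_1))"
proof -
  have closed: "action_formula G f m \<in> free_module_on W"
    if fm: "f \<in> steinberg G" "m \<in> free_module_on W" for f m :: "'g \<Rightarrow> 'r"
  proof -
    let ?S = "{x. f x * m (gdom G x) \<noteq> 0}"
    have sub: "{v. action_formula G f m v \<noteq> 0} \<subseteq> gran G ` ?S"
    proof
      fix v assume "v \<in> {v. action_formula G f m v \<noteq> 0}"
      then have ne: "Sum_any (\<lambda>x. if gran G x = v then f x * m (gdom G x) else 0) \<noteq> 0"
        unfolding action_formula_def by (rule CollectD)
      obtain x where "(if gran G x = v then f x * m (gdom G x) else 0) \<noteq> 0"
        by (rule Sum_any.not_neutral_obtains_not_neutral[OF ne])
      then show "v \<in> gran G ` ?S" by (auto split: if_splits)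
    qed
    have "gran G x \<in> W" if "x \<in> ?S" for x
    proof -
      have "f x \<noteq> 0" "m (gdom G x) \<noteq> 0" using that by auto
      then have "x \<in> arrows G" "gdom G x \<in> W"
        using fm steinberg_zero_off[of f G x] by (auto simp: free_module_on_def)
      then show ?thesis using inv by (auto simp: invariant_def)
    qed
    then show ?thesis
      unfolding free_module_on_def
      using sub finite_subset[OF sub] action_formula_finite[OF fm] by blast
  qed
  have add1: "action_formula G (f + g) m = action_formula G f m + action_formula G g m"
    if fm: "f \<in> steinberg G" "g \<in> steinberg G" "m \<in> free_module_on W" for f g m :: "'g \<Rightarrow> 'r"
  proof
    fix v
    have "(\<lambda>x. if gran G x = v then (f + g) x * m (gdom G x) else 0) = (\<lambda>x. (if gran G x = v then f x * m (gdom G x) else 0) + (if gran G x = v then g x * m (gdom G x) else 0))"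
      by (auto simp: fun_eq_iff algebra_simps)
    with Sum_any.distrib[OF action_formula_finite'[OF fm(1,3), of v] action_formula_finite'[OF fm(2,3), of v]]
    show "action_formula G (f + g) m v = (action_formula G f m + action_formula G g m) v"
      unfolding action_formula_def plus_fun_apply by metis
  qed
  have add2: "action_formula G f (m + n) = action_formula G f m + action_formula G f n"
    if fm: "f \<in> steinberg G" "m \<in> free_module_on W" "n \<in> free_module_on W" for f m n :: "'g \<Rightarrow> 'r"
  proof
    fix v
    have "(\<lambda>x. if gran G x = v then f x * (m + n) (gdom G x) else 0) = (\<lambda>x. (if gran G x = v then f x * m (gdom G x) else 0) + (if gran G x = v then f x * n (gdom G x) else 0))"
      by (auto simp: fun_eq_iff algebra_simps)
    with Sum_any.distrib[OF action_formula_finite'[OF fm(1,2), of v] action_formula_finite'[OF fm(1,3), of v]]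
    show "action_formula G f (m + n) v = (action_formula G f m + action_formula G f n) v"
      unfolding action_formula_def plus_fun_apply by metis
  qed
  have scale1: "action_formula G (fscale a f) m = fscale a (action_formula G f m)"
    if fm: "f \<in> steinberg G" "m \<in> free_module_on W" for a and f m :: "'g \<Rightarrow> 'r"
  proof
    fix v
    have "(\<lambda>x. if gran G x = v then fscale a f x * m (gdom G x) else 0) = (\<lambda>x. a * (if gran G x = v then f x * m (gdom G x) else 0))"
      by (auto simp: fun_eq_iff fscale_def algebra_simps)
    with Sum_any_right_distrib[OF action_formula_finite'[OF fm, of v], of a]
    show "action_formula G (fscale a f) m v = fscale a (action_formula G f m) v"
      unfolding action_formula_def fscale_def[of a "\<lambda>v. Sum_any (_ v)"] by metis
  qed
  have scale2: "action_formula G f (fscale a m) = fscale a (action_formula G f m)"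
    if fm: "f \<in> steinberg G" "m \<in> free_module_on W" for a and f m :: "'g \<Rightarrow> 'r"
  proof
    fix v
    have "(\<lambda>x. if gran G x = v then f x * fscale a m (gdom G x) else 0) = (\<lambda>x. a * (if gran G x = v then f x * m (gdom G x) else 0))"
      by (auto simp: fun_eq_iff fscale_def algebra_simps)
    with Sum_any_right_distrib[OF action_formula_finite'[OF fm, of v], of a]
    show "action_formula G f (fscale a m) v = fscale a (action_formula G f m) v"
      unfolding action_formula_def fscale_def[of a "\<lambda>v. Sum_any (_ v)"] by metis
  qed
  have zero: "action_formula G (indicator B) (indicator {u}) = (0 :: 'g \<Rightarrow> 'r)"
    if "u \<notin> gdom G ` B" for B u
  proof -
    have *: "(if gran G x = v then indicator B x * indicator {u} (gdom G x) else 0) = (0 :: 'r)" for x v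
      using that by (auto simp: indicator_def)
    show ?thesis unfolding action_formula_def * by (simp add: zero_fun_def)
  qed
  have basis: "action_formula G (indicator B) (indicator {u}) = (indicator {gran G b} :: 'g \<Rightarrow> 'r)"
    if "compact_open_bisection G B" "b \<in> B" "gdom G b = u" for B u b
    using action_formula_indicator[OF that(1,2)] that(3) by metis
  show ?thesis
    unfolding is_steinberg_action_def
    by (intro conjI ballI allI impI)
      (simp_all add: closed add1 add2 scale1 scale2 zero basis
        steinberg_indicator steinberg_add steinberg_scale
        free_module_on_basis free_module_on_add free_module_on_scale, auto?)
qed

lemma
  assumes "is_steinberg_action G W act"
  shows is_steinberg_action_off:
      "\<not> (f \<in> steinberg G \<and> m \<in> free_module_on W) \<Longrightarrow> act f m = 0"
    and is_steinberg_action_add_left: "f \<in> steinberg G \<Longrightarrow> g \<in> steinberg G \<Longrightarrow> m \<in> free_module_on W \<Longrightarrow>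
      act (f + g) m = act f m + act g m"
    and is_steinberg_action_add_right: "f \<in> steinberg G \<Longrightarrow> m \<in> free_module_on W \<Longrightarrow> n \<in> free_module_on W \<Longrightarrow>
      act f (m + n) = act f m + act f n"
    and is_steinberg_action_scale_left: "f \<in> steinberg G \<Longrightarrow> m \<in> free_module_on W \<Longrightarrow>
      act (fscale a f) m = fscale a (act f m)"
    and is_steinberg_action_scale_right: "f \<in> steinberg G \<Longrightarrow> m \<in> free_module_on W \<Longrightarrow>
      act f (fscale a m) = fscale a (act f m)"
    and is_steinberg_action_basis: "compact_open_bisection G B \<Longrightarrow> gdom G b \<in> W \<Longrightarrow> b \<in> B \<Longrightarrow>
      act (indicator B) (indicator {gdom G b}) = indicator {gran G b}"
    and is_steinberg_action_basis_off: "compact_open_bisection G B \<Longrightarrow> u \<in> W \<Longrightarrow> u \<notin> gdom G ` B \<Longrightarrow>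
      act (indicator B) (indicator {u}) = 0"
  using assms unfolding is_steinberg_action_def by simp_all

lemma is_steinberg_action_zero:
  assumes "is_steinberg_action G W act" "f \<in> steinberg G" "m \<in> free_module_on W"
  shows "act 0 m = 0" "act f 0 = 0"
proof -
  have "fscale 0 h = 0" for h :: "'a \<Rightarrow> 'b" by (auto simp: fscale_def)
  with is_steinberg_action_scale_left[OF assms, of 0] is_steinberg_action_scale_right[OF assms, of 0]
  show "act 0 m = 0" "act f 0 = 0" by simp_all
qed

lemma is_steinberg_action_unique:
  assumes a: "is_steinberg_action G W act" and a': "is_steinberg_action G W act'"
  shows "act = act'"
proof -
  have "act f m = act' f m" if f: "f \<in> steinberg G" and m: "m \<in> free_module_on W" for f m
    using m
  proof (induction rule: free_module_on_induct)
    case zero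
    show ?case
      using is_steinberg_action_zero(2)[OF a f m] is_steinberg_action_zero(2)[OF a' f m] by metis
  next
    case (add r u n)
    note u = free_module_on_basis[OF add(1)]
    have basis: "act f (indicator {u}) = act' f (indicator {u})"
      using f
    proof (induction rule: steinberg_induct)
      case zero
      show ?case
        using is_steinberg_action_zero(1)[OF a f u] is_steinberg_action_zero(1)[OF a' f u] by metis
    next
      case (add s B g)
      note B = steinberg_indicator[OF add(1)]
      have "act (indicator B) (indicator {u}) = act' (indicator B) (indicator {u})"
      proof (cases "u \<in> gdom G ` B")
        case True
        then obtain b where b: "b \<in> B" "u = gdom G b" by auto
        then show ?thesis
          using is_steinberg_action_basis[OF a add(1)] is_steinberg_action_basis[OF a' add(1)]
            \<open>u \<in> W\<close> by simp
      next
        case False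
        then show ?thesis
          using is_steinberg_action_basis_off[OF a add(1)] is_steinberg_action_basis_off[OF a' add(1)]
            \<open>u \<in> W\<close> by simp
      qed
      then show ?case
        using is_steinberg_action_add_left[OF a steinberg_scale[OF B] add(2) u]
          is_steinberg_action_add_left[OF a' steinberg_scale[OF B] add(2) u]
          is_steinberg_action_scale_left[OF a B u] is_steinberg_action_scale_left[OF a' B u] add(3)
        by metis
    qed
    show ?case
      using is_steinberg_action_add_right[OF a f free_module_on_scale[OF u] add(2)]
        is_steinberg_action_add_right[OF a' f free_module_on_scale[OF u] add(2)]
        is_steinberg_action_scale_right[OF a f u] is_steinberg_action_scale_right[OF a' f u]
        basis add(3)
      by metis
  qed
  moreover have "act f m = act' f m" if "\<not> (f \<in> steinberg G \<and> m \<in> free_module_on W)" for f m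
    using is_steinberg_action_off[OF a that] is_steinberg_action_off[OF a' that] by simp
  ultimately show ?thesis by (intro ext) metis
qed

theorem is_steinberg_action_steinberg_action:
  assumes "invariant G W"
  shows "is_steinberg_action G W (steinberg_action G W)"
  unfolding steinberg_action_def
  by (rule theI[where P = "is_steinberg_action G W", OF is_steinberg_action_formula[OF assms]])
    (rule is_steinberg_action_unique[OF _ is_steinberg_action_formula[OF assms]])

theorem steinberg_action_eq:
  assumes "invariant G W" "f \<in> steinberg G" "m \<in> free_module_on W"
  shows "steinberg_action G W f m = action_formula G f m"
  using assms by (simp add: is_steinberg_action_unique[OF is_steinberg_action_steinberg_action
      is_steinberg_action_formula, OF assms(1) assms(1)])

end

theory Submission
  imports Defs
begin

text \<open>
  Both conditions are compared for one fixed \<open>W\<close>. A function over \<open>U\<close> always annihilates \<open>RW\<close>,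
  and \<open>U\<close> is the complement of the closure of \<open>W\<close>, so the annihilator equals the algebra over \<open>U\<close>
  exactly when its elements vanish at all arrows over the closure.
  If \<open>f x \<noteq> 0\<close> there, take a bisection \<open>B\<close> around \<open>x\<close> on which \<open>f\<close> is constant: effectiveness makes
  the sources at which some other arrow of the support is parallel to \<open>B\<close> nowhere dense, and at a
  remaining point \<open>w\<close> of \<open>W\<close> the element \<open>f \<cdot> w\<close> has the nonzero coefficient \<open>f x\<close>. Aperiodicity
  enters because the quotient of two parallel arrows over \<open>W\<close> has degree zero.
  Conversely, if the kernel is not effective, some bisection \<open>B\<close> off the unit space consists
  of isotropy over the closure of \<open>W\<close>, and \<open>1\<^sub>B - 1\<^bsub>d(B)\<^esub>\<close> annihilates \<open>RW\<close> without vanishing there.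
\<close>

section \<open>Units, invariant sets and degrees of units\<close>

context groupoid
begin

lemma dom_arrow [simp]: "x \<in> arrows G \<Longrightarrow> gdom G x \<in> arrows G"
  and dom_dom [simp]: "x \<in> arrows G \<Longrightarrow> gdom G (gdom G x) = gdom G x"
  and ran_dom [simp]: "x \<in> arrows G \<Longrightarrow> gran G (gdom G x) = gdom G x"
proof -
  assume x: "x \<in> arrows G"
  then have c: "(ginv G x, x) \<in> composable G"
    by (simp add: composable_def inv_closed dom_inv)
  show "gdom G x \<in> arrows G" using mult_closed[OF c] by (simp add: gdom_def)
  show "gdom G (gdom G x) = gdom G x" using dom_mult[OF c] by (simp add: gdom_def)
  show "gran G (gdom G x) = gdom G x" using ran_mult[OF c] ran_inv[OF x] by (simp add: gdom_def)
qed

lemma dom_unit [simp]: "x \<in> arrows G \<Longrightarrow> gdom G x \<in> units G"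
  by (simp add: units_def)

lemma ran_unit [simp]: "x \<in> arrows G \<Longrightarrow> gran G x \<in> units G"
  using dom_unit[OF inv_closed] by (simp add: dom_inv)

lemma units_iff: "u \<in> units G \<longleftrightarrow> u \<in> arrows G \<and> gdom G u = u"
  by (auto simp: units_def) (metis imageI)

lemma unit_ran: "u \<in> units G \<Longrightarrow> gran G u = u"
  using ran_dom[of u] by (simp add: units_iff)

lemma ran_arrow [simp]: "x \<in> arrows G \<Longrightarrow> gran G x \<in> arrows G"
  using ran_unit units_iff by blast

text \<open>Invariance applied to \<open>ginv G x\<close>, whose source and range are swapped, gives
  the direction from range to source. Complements of invariant sets are therefore invariant.\<close>

lemma invariant_ran_iff:
  assumes "invariant G W" "x \<in> arrows G"
  shows "gran G x \<in> W \<longleftrightarrow> gdom G x \<in> W"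
  using assms inv_closed[of x] dom_inv[of x] ran_inv[of x] unfolding invariant_def by metis

text \<open>A unit is idempotent, and the identity is the only idempotent of a group.\<close>

lemma grading_unit:
  assumes "grading G c" "u \<in> units G"
  shows "c u = 0"
proof -
  have u: "u \<in> arrows G" "gdom G u = u" "gran G u = u"
    using assms(2) by (auto simp: units_iff unit_ran)
  then have "c (gmult G u u) = c u + c u"
    using assms(1) by (auto simp: grading_def composable_def)
  then have "c u + c u = c u + 0" using mult_dom[of u] u by simp
  then show ?thesis by (simp only: add_left_cancel)
qed

end

section \<open>Reductions and grading kernels as subspaces of \<open>G\<close>\<close>

lemma arrows_subgroupoid: "arrows (subgroupoid G H) = arrows G \<inter> H"
  by (simp add: arrows_def subgroupoid_def)

lemma gdom_subgroupoid [simp]: "gdom (subgroupoid G H) = gdom G"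
  and gran_subgroupoid [simp]: "gran (subgroupoid G H) = gran G"
  by (auto simp: gdom_def gran_def subgroupoid_def fun_eq_iff)

lemma arrows_reduction: "arrows (reduction G W) = {x \<in> arrows G. gdom G x \<in> W}"
  by (auto simp: reduction_def arrows_subgroupoid)

lemma gdom_reduction [simp]: "gdom (reduction G W) = gdom G"
  and gran_reduction [simp]: "gran (reduction G W) = gran G"
  by (simp_all add: reduction_def)

lemma gtop_reduction: "gtop (reduction G W) = subtopology (gtop G) {x \<in> arrows G. gdom G x \<in> W}"
  by (simp add: reduction_def subgroupoid_def)

lemma arrows_kernel_reduction:
  "arrows (grading_kernel (reduction G W) c) = {x \<in> arrows G. gdom G x \<in> W \<and> c x = 0}"
  by (auto simp: grading_kernel_def arrows_subgroupoid arrows_reduction)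

lemma gtop_kernel_reduction:
  "gtop (grading_kernel (reduction G W) c) =
    subtopology (gtop G) {x \<in> arrows G. gdom G x \<in> W \<and> c x = 0}"
proof -
  have "{x \<in> arrows G. gdom G x \<in> W} \<inter> {x \<in> arrows (reduction G W). c x = 0} =
      {x \<in> arrows G. gdom G x \<in> W \<and> c x = 0}"
    by (auto simp: arrows_reduction)
  then show ?thesis
    by (simp add: grading_kernel_def subgroupoid_def gtop_reduction subtopology_subtopology)
qed

lemma gdom_kernel [simp]: "gdom (grading_kernel G c) = gdom G"
  and gran_kernel [simp]: "gran (grading_kernel G c) = gran G"
  by (simp_all add: grading_kernel_def)

section \<open>Continuity of source and range\<close>

context topological_groupoid
begin

text \<open>Each map is the multiplication composed with a continuous map that pairs an arrow with
  its inverse and takes values in the composable pairs.\<close>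

lemma continuous_dom: "continuous_map (gtop G) (gtop G) (gdom G)"
  and continuous_ran: "continuous_map (gtop G) (gtop G) (gran G)"
proof -
  have "continuous_map (gtop G) (subtopology (prod_topology (gtop G) (gtop G)) (composable G))
      (\<lambda>x. (ginv G x, x))"
    by (auto simp: continuous_map_in_subtopology continuous_map_pairwise o_def continuous_inv
        composable_def arrows_def[symmetric] inv_closed dom_inv)
  from continuous_map_compose[OF this continuous_mult]
  show "continuous_map (gtop G) (gtop G) (gdom G)" by (simp add: o_def gdom_def[abs_def])
  have "continuous_map (gtop G) (subtopology (prod_topology (gtop G) (gtop G)) (composable G))
      (\<lambda>x. (x, ginv G x))"
    by (auto simp: continuous_map_in_subtopology continuous_map_pairwise o_def continuous_inv
        composable_def arrows_def[symmetric] inv_closed ran_inv)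
  from continuous_map_compose[OF this continuous_mult]
  show "continuous_map (gtop G) (gtop G) (gran G)" by (simp add: o_def gran_def[abs_def])
qed

lemma continuous_dom_unit_top: "continuous_map (gtop G) (unit_top G) (gdom G)"
  and continuous_ran_unit_top: "continuous_map (gtop G) (unit_top G) (gran G)"
  by (auto simp: unit_top_def continuous_map_in_subtopology continuous_dom continuous_ran
      arrows_def[symmetric])

lemma topspace_unit_top [simp]: "topspace (unit_top G) = units G"
  using units_iff by (auto simp: unit_top_def arrows_def)

end

section \<open>Openness of source and range, bisections and the unit space\<close>

context ample_groupoid
begin

text \<open>Bisections have open images by definition and form a basis.\<close>

lemma open_map_dom: "open_map (gtop G) (unit_top G) (gdom G)"
  and open_map_ran: "open_map (gtop G) (unit_top G) (gran G)"
proof -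
  have *: "openin (unit_top G) (f ` V)"
    if V: "openin (gtop G) V" and f: "\<And>B. compact_open_bisection G B \<Longrightarrow> openin (unit_top G) (f ` B)"
    for f V
  proof (subst openin_subopen, safe)
    fix x assume "x \<in> V"
    with bisection_basis[OF V] obtain B where "compact_open_bisection G B" "x \<in> B" "B \<subseteq> V" by blast
    with f[of B] show "\<exists>T. openin (unit_top G) T \<and> f x \<in> T \<and> T \<subseteq> f ` V"
      by blast
  qed
  show "open_map (gtop G) (unit_top G) (gdom G)" "open_map (gtop G) (unit_top G) (gran G)"
    using *[of _ "gdom G"] *[of _ "gran G"]
    by (simp_all add: open_map_def compact_open_bisection_def)
qed

text \<open>An injective continuous open map on an open set is a homeomorphism onto its image, so
  the homeomorphism clauses reduce to injectivity.\<close>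

lemma compact_open_bisection_iff:
  "compact_open_bisection G B \<longleftrightarrow> compactin (gtop G) B \<and> openin (gtop G) B \<and>
    inj_on (gdom G) B \<and> inj_on (gran G) B" (is "?l \<longleftrightarrow> ?r")
proof
  assume l: ?l
  then have "topspace (subtopology (gtop G) B) = B"
    by (simp add: compact_open_bisection_def openin_subset Int_absorb1)
  with l show ?r
    unfolding compact_open_bisection_def
    using homeomorphic_imp_injective_map[of "subtopology (gtop G) B"] by auto
next
  assume r: ?r
  have hom: "homeomorphic_map (subtopology (gtop G) B) (subtopology (unit_top G) (f ` B)) f"
    if f: "continuous_map (gtop G) (unit_top G) f" "open_map (gtop G) (unit_top G) f" "inj_on f B" for f
  proof (rule bijective_open_imp_homeomorphic_map)
    have B: "B \<subseteq> topspace (gtop G)" using r openin_subset by blast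
    then have fB: "f ` B \<subseteq> topspace (unit_top G)"
      using continuous_map_image_subset_topspace[OF f(1)] by blast
    show "continuous_map (subtopology (gtop G) B) (subtopology (unit_top G) (f ` B)) f"
      using f(1) by (auto simp: continuous_map_in_subtopology continuous_map_from_subtopology)
    show "open_map (subtopology (gtop G) B) (subtopology (unit_top G) (f ` B)) f"
      using r f(2) by (intro open_map_into_subtopology open_map_from_subtopology) auto
    show "f ` topspace (subtopology (gtop G) B) = topspace (subtopology (unit_top G) (f ` B))"
      using B fB by auto
    show "inj_on f (topspace (subtopology (gtop G) B))"
      using f(3) by (auto intro: inj_on_subset)
  qed
  show ?l
    unfolding compact_open_bisection_def
    using r hom continuous_dom_unit_top continuous_ran_unit_top open_map_dom open_map_ran
    by (auto simp: open_map_def)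
qed

lemma compact_open_bisection_inter:
  assumes "compact_open_bisection G B" "openin (gtop G) S" "closedin (gtop G) S"
  shows "compact_open_bisection G (B \<inter> S)"
  using assms by (auto simp: compact_open_bisection_iff compact_Int_closedin intro: inj_on_subset)

text \<open>If \<open>u\<close> lies in a bisection \<open>B\<close>, any \<open>x\<close> in
  \<open>B\<close> with d(x) in \<open>B\<close> has the same source as d(x), so injectivity on
  \<open>B\<close> forces x = d(x). Such \<open>x\<close> form an open neighbourhood of
  \<open>u\<close>.\<close>

lemma openin_units: "openin (gtop G) (units G)"
proof (subst openin_subopen, safe)
  fix u assume u: "u \<in> units G"
  then have "u \<in> topspace (gtop G)" by (simp add: units_iff arrows_def)
  then obtain B where B: "compact_open_bisection G B" "u \<in> B"
    using bisection_basis[OF openin_topspace] by blast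
  then have "openin (gtop G) B" by (simp add: compact_open_bisection_iff)
  have "openin (gtop G) ({x \<in> topspace (gtop G). gdom G x \<in> B} \<inter> B)"
    using B by (intro openin_Int openin_continuous_map_preimage[OF continuous_dom])
      (auto simp: compact_open_bisection_iff)
  moreover have "x \<in> units G" if "x \<in> B" "x \<in> topspace (gtop G)" "gdom G x \<in> B" for x
    using that inj_onD[OF compact_open_bisection_inj_on[OF B(1)], of "gdom G x" x]
    by (simp add: arrows_def[symmetric] units_iff)
  ultimately show "\<exists>T. openin (gtop G) T \<and> u \<in> T \<and> T \<subseteq> units G"
    using u B(2) by (intro exI[of _ "{x \<in> topspace (gtop G). gdom G x \<in> B} \<inter> B"])
      (auto simp: units_iff arrows_def)
qed

lemma openin_unit_top_iff: "openin (unit_top G) U \<longleftrightarrow> openin (gtop G) U \<and> U \<subseteq> units G"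
  unfolding unit_top_def using openin_open_subtopology[OF openin_units] by blast

lemma open_image_dom: "openin (gtop G) V \<Longrightarrow> openin (gtop G) (gdom G ` V)"
  using open_map_dom by (auto simp: open_map_def openin_unit_top_iff)

lemma openin_dom_preimage: "openin (gtop G) V \<Longrightarrow> openin (gtop G) {x \<in> arrows G. gdom G x \<in> V}"
  and openin_ran_preimage: "openin (gtop G) V \<Longrightarrow> openin (gtop G) {x \<in> arrows G. gran G x \<in> V}"
  using openin_continuous_map_preimage[OF continuous_dom]
    openin_continuous_map_preimage[OF continuous_ran] by (auto simp: arrows_def)

text \<open>The range map is open, so the ranges of all arrows starting in the interior form an open
  subset of \<open>W\<close>.\<close>

lemma invariant_interior_of:
  assumes W: "invariant G W"
  shows "invariant G (unit_top G interior_of W)" (is "invariant G ?U")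
proof -
  have "gran G x \<in> ?U" if x: "x \<in> arrows G" "gdom G x \<in> ?U" for x
  proof -
    let ?V = "{x \<in> arrows G. gdom G x \<in> ?U}"
    have "openin (gtop G) ?U" using openin_interior_of openin_unit_top_iff by blast
    then have "openin (unit_top G) (gran G ` ?V)"
      using open_map_ran openin_dom_preimage by (simp add: open_map_def)
    moreover have "gran G ` ?V \<subseteq> W"
      using W interior_of_subset[of "unit_top G" W] by (auto simp: invariant_def)
    ultimately have "gran G ` ?V \<subseteq> ?U" by (rule interior_of_maximal[rotated])
    then show ?thesis using x by blast
  qed
  then show ?thesis
    using interior_of_subset_topspace[of "unit_top G" W] by (auto simp: invariant_def)
qed

text \<open>For open \<open>U\<close> the reduction and its unit space are open subspaces of
  \<open>G\<close> and its unit space, so compactness and openness of their subsets mean the same as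
  in the ambient spaces.\<close>

lemma compact_open_bisection_reduction:
  assumes U: "invariant G U" "openin (gtop G) U"
  shows "compact_open_bisection (reduction G U) B \<longleftrightarrow>
    compact_open_bisection G B \<and> (\<forall>x\<in>B. gdom G x \<in> U)" (is "?l \<longleftrightarrow> ?r")
proof -
  let ?D = "{x \<in> arrows G. gdom G x \<in> U}"
  have Uu: "U \<subseteq> units G" using U(1) by (simp add: invariant_def)
  then have UD: "U \<subseteq> ?D" using units_iff by auto
  have "u \<in> gdom G ` ?D" if "u \<in> U" for u
    using that UD Uu units_iff[of u] by (intro image_eqI[of _ _ u]) auto
  then have "units (reduction G U) = U"
    by (auto simp: units_def[of "reduction G U"] arrows_reduction)
  then have top: "unit_top (reduction G U) = subtopology (unit_top G) U"
    using UD Uu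
    by (simp add: unit_top_def gtop_reduction subtopology_subtopology Int_absorb1)
  have D: "openin (gtop G) ?D" by (rule openin_dom_preimage[OF U(2)])
  have eq: "compact_open_bisection (reduction G U) B \<longleftrightarrow> compact_open_bisection G B" if B: "B \<subseteq> ?D"
  proof -
    have dB: "gdom G ` B \<subseteq> U" and rB: "gran G ` B \<subseteq> U"
      using B U(1) by (auto simp: invariant_def)
    have "openin (unit_top G) U" using U(2) Uu by (simp add: openin_unit_top_iff)
    then show ?thesis
      using B dB rB D
      by (simp add: compact_open_bisection_def top gtop_reduction subtopology_subtopology
          Int_absorb1 compactin_subtopology openin_open_subtopology)
  qed
  show ?thesis
  proof
    assume ?l
    from compact_open_bisection_subset[OF this] have "B \<subseteq> ?D" by (simp add: arrows_reduction)
    with \<open>?l\<close> eq show ?r by auto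
  next
    assume ?r
    then have "B \<subseteq> ?D" using compact_open_bisection_subset[of G B] by auto
    with \<open>?r\<close> eq show ?l by auto
  qed
qed

section \<open>The Steinberg algebra over open invariant sets, and supports of its elements\<close>

lemma steinberg_reduction_subset:
  assumes "invariant G U" "openin (gtop G) U"
  shows "steinberg (reduction G U) \<subseteq> steinberg G"
proof
  fix f assume "f \<in> steinberg (reduction G U)"
  then show "f \<in> steinberg G"
  proof (induction rule: steinberg_induct)
    case zero
    show ?case by (rule steinberg_zero)
  next
    case (add a B g)
    from add(1) have "compact_open_bisection G B"
      using compact_open_bisection_reduction[OF assms] by blast
    with add(3) show ?case by (intro steinberg_add steinberg_scale steinberg_indicator)
  qed
qed

end

text \<open>Lets a condition on the whole support be imposed one bisection at a time.\<close>

lemma steinberg_support_cover: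
  assumes "f \<in> steinberg G"
  shows "\<exists>\<C>. finite \<C> \<and> (\<forall>C\<in>\<C>. compact_open_bisection G C) \<and> {x. f x \<noteq> 0} \<subseteq> \<Union>\<C>"
  using assms
proof (induction rule: steinberg_induct)
  case zero
  then show ?case by (intro exI[of _ "{}"]) auto
next
  case (add a B g)
  then obtain \<C> where "finite \<C>" "\<forall>C\<in>\<C>. compact_open_bisection G C" "{x. g x \<noteq> 0} \<subseteq> \<Union>\<C>"
    by blast
  moreover have "x \<in> B \<or> g x \<noteq> 0" if "(fscale a (indicator B) + g) x \<noteq> 0" for x
    using that by (cases "x \<in> B") (simp_all add: fscale_def)
  ultimately show ?case using add(1) by (intro exI[of _ "insert B \<C>"]) blast
qed

text \<open>Hausdorffness enters in three ways: compact sets are closed, sets where two continuous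
  maps agree are closed, and distinct ranges can be separated.\<close>

locale hausdorff_ample_groupoid = ample_groupoid +
  assumes hausdorff: "Hausdorff_space (gtop G)"
begin

lemma closedin_compact_open_bisection: "compact_open_bisection G B \<Longrightarrow> closedin (gtop G) B"
  by (auto simp: compact_open_bisection_iff intro: compactin_imp_closedin[OF hausdorff])

lemma closedin_units: "closedin (gtop G) (units G)"
proof -
  have "units G = {x \<in> topspace (gtop G). gdom G x = x}" by (auto simp: units_iff arrows_def)
  then show ?thesis
    using closedin_continuous_maps_eq[OF hausdorff continuous_dom, of id] by simp
qed

text \<open>The set where source and range agree is closed. This lets isotropy over \<open>W\<close>
  pass to the closure of \<open>W\<close>.\<close>

lemma openin_dom_neq_ran: "openin (gtop G) {x \<in> arrows G. gdom G x \<noteq> gran G x}"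
proof -
  have "{x \<in> arrows G. gdom G x \<noteq> gran G x} =
      topspace (gtop G) - {x \<in> topspace (gtop G). gdom G x = gran G x}"
    by (auto simp: arrows_def)
  then show ?thesis
    using closedin_continuous_maps_eq[OF hausdorff continuous_dom continuous_ran] by auto
qed

text \<open>Compact open bisections are clopen, and the indicator of a clopen set is locally
  constant.\<close>

lemma steinberg_locally_constant:
  assumes "f \<in> steinberg G" "x \<in> arrows G"
  shows "\<exists>V. openin (gtop G) V \<and> x \<in> V \<and> (\<forall>y\<in>V. f y = f x)"
  using assms
proof (induction rule: steinberg_induct)
  case zero
  then show ?case by (intro exI[of _ "arrows G"]) (auto simp: arrows_def)
next
  case (add a B g)
  then obtain V where V: "openin (gtop G) V" "x \<in> V" "\<forall>y\<in>V. g y = g x" by blast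
  define N where "N = (if x \<in> B then V \<inter> B else V - B)"
  have N: "openin (gtop G) N"
    using V(1) add(1) closedin_compact_open_bisection[OF add(1)]
    by (simp add: N_def compact_open_bisection_iff openin_Int openin_diff)
  have "(fscale a (indicator B) + g) y = (fscale a (indicator B) + g) x" if "y \<in> N" for y
  proof -
    have "g y = g x" "y \<in> B \<longleftrightarrow> x \<in> B" using that V(3) by (auto simp: N_def split: if_splits)
    then show ?thesis by (simp add: fscale_def indicator_def)
  qed
  moreover have "x \<in> N" using V(2) by (simp add: N_def)
  ultimately show ?case using N by blast
qed

lemma steinberg_support_clopen:
  assumes f: "f \<in> steinberg G"
  shows "openin (gtop G) {x. f x \<noteq> 0}" "closedin (gtop G) {x. f x \<noteq> 0}"
proof -
  have sub: "{x. f x \<noteq> 0} \<subseteq> arrows G" using steinberg_zero_off[OF f] by blast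
  show "openin (gtop G) {x. f x \<noteq> 0}"
  proof (subst openin_subopen, safe)
    fix x assume "f x \<noteq> 0"
    then have "x \<in> arrows G" using sub by blast
    from steinberg_locally_constant[OF f this] obtain V where
      V: "openin (gtop G) V" "x \<in> V" "\<forall>y\<in>V. f y = f x" by (elim exE conjE)
    have "V \<subseteq> {x. f x \<noteq> 0}" using bspec[OF V(3)] \<open>f x \<noteq> 0\<close> by auto
    with V(1,2) show "\<exists>T. openin (gtop G) T \<and> x \<in> T \<and> T \<subseteq> {x. f x \<noteq> 0}" by blast
  qed
  have "openin (gtop G) (topspace (gtop G) - {x. f x \<noteq> 0})"
  proof (subst openin_subopen, intro ballI)
    fix x assume "x \<in> topspace (gtop G) - {x. f x \<noteq> 0}"
    then have "f x = 0" "x \<in> topspace (gtop G)" by auto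
    from steinberg_locally_constant[OF f this(2)[folded arrows_def]] obtain V where
      V: "openin (gtop G) V" "x \<in> V" "\<forall>y\<in>V. f y = f x" by (elim exE conjE)
    have "V \<subseteq> topspace (gtop G) - {x. f x \<noteq> 0}"
      using openin_subset[OF V(1)] bspec[OF V(3)] \<open>f x = 0\<close> by auto
    with V(1,2) show "\<exists>T. openin (gtop G) T \<and> x \<in> T \<and> T \<subseteq> topspace (gtop G) - {x. f x \<noteq> 0}"
      by blast
  qed
  then show "closedin (gtop G) {x. f x \<noteq> 0}"
    using sub by (simp add: closedin_def arrows_def)
qed

(* Cutting each bisection down to the clopen support of f keeps it a compact open bisection,
   so no disjoint refinement is needed. *)
lemma steinberg_reduction_iff:
  assumes U: "invariant G U" "openin (gtop G) U"
  shows "f \<in> steinberg (reduction G U) \<longleftrightarrow> f \<in> steinberg G \<and> (\<forall>x. f x \<noteq> 0 \<longrightarrow> gdom G x \<in> U)"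
proof safe
  assume f: "f \<in> steinberg (reduction G U)"
  then show "f \<in> steinberg G" using steinberg_reduction_subset[OF U] by blast
  show "gdom G x \<in> U" if "f x \<noteq> 0" for x
    using steinberg_zero_off[OF f, of x] that by (auto simp: arrows_reduction)
next
  assume f: "f \<in> steinberg G" and supp: "\<forall>x. f x \<noteq> 0 \<longrightarrow> gdom G x \<in> U"
  let ?S = "{x. f x \<noteq> 0}"
  \<comment> \<open>The product is pointwise, not convolution. The set \<open>?S\<close> stays the
    support of \<open>f\<close> while the induction runs over \<open>g\<close>; the instance
    \<open>g = f\<close> finishes, since cutting \<open>f\<close> by its own support changes
    nothing.\<close>
  have "indicator ?S * g \<in> steinberg (reduction G U)" if "g \<in> steinberg G" for g :: "'a \<Rightarrow> 'b"
    using that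
  proof (induction rule: steinberg_induct)
    case zero
    show ?case unfolding mult_zero_right by (rule steinberg_zero)
  next
    case (add a B g)
    have eq: "indicator ?S * (fscale a (indicator B) + g) =
        fscale a (indicator (B \<inter> ?S)) + indicator ?S * g"
      by (auto simp: fun_eq_iff fscale_def indicator_def)
    have "compact_open_bisection (reduction G U) (B \<inter> ?S)"
      using compact_open_bisection_inter[OF add(1) steinberg_support_clopen[OF f]] supp
      by (simp add: compact_open_bisection_reduction[OF U])
    with add(3) show ?case
      unfolding eq by (intro steinberg_add steinberg_scale steinberg_indicator)
  qed
  from this[OF f] have "indicator ?S * f \<in> steinberg (reduction G U)" .
  moreover have "indicator ?S * f = f" by (auto simp: fun_eq_iff indicator_def)
  ultimately show "f \<in> steinberg (reduction G U)" by simp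
qed

section \<open>Effectiveness of the degree-zero part over a set of units\<close>

lemma units_kernel_reduction:
  assumes "grading G c" "Z \<subseteq> units G"
  shows "units (grading_kernel (reduction G Z) c) = Z"
proof -
  have "u \<in> gdom G ` {x \<in> arrows G. gdom G x \<in> Z \<and> c x = 0}" if "u \<in> Z" for u
    using that assms grading_unit[OF assms(1), of u] units_iff[of u] by (intro image_eqI[of _ _ u]) auto
  then show ?thesis
    by (auto simp: units_def[of "grading_kernel _ _"] arrows_kernel_reduction)
qed

lemma Iso_kernel_reduction:
  assumes "grading G c" "Z \<subseteq> units G"
  shows "(\<Union>u\<in>units (grading_kernel (reduction G Z) c). Iso (grading_kernel (reduction G Z) c) u) =
    {x \<in> arrows G. gdom G x \<in> Z \<and> c x = 0 \<and> gran G x = gdom G x}"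
  by (auto simp: units_kernel_reduction[OF assms] Iso_def arrows_kernel_reduction)

lemma openin_grading_fibre:
  assumes "grading G c"
  shows "openin (gtop G) {x \<in> arrows G. c x = \<gamma>}"
  using openin_continuous_map_preimage[of "gtop G" "discrete_topology UNIV" c "{\<gamma>}"] assms
  by (simp add: grading_def arrows_def)

text \<open>Relatively open sets of the kernel are traces of open sets of \<open>G\<close>, so
  effectiveness can be tested by open \<open>V\<close> in \<open>G\<close>. Such a \<open>V\<close>
  may be shrunk to degree zero because the degree-zero arrows form an open set.\<close>

lemma effective_kernel_reduction_iff:
  assumes c: "grading G c" and Z: "Z \<subseteq> units G"
  shows "effective (grading_kernel (reduction G Z) c) \<longleftrightarrow>
    (\<forall>V. openin (gtop G) V \<and> (\<forall>x\<in>V. c x = 0) \<and> (\<forall>x\<in>V. gdom G x \<in> Z \<longrightarrow> gran G x = gdom G x) \<longrightarrow>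
      (\<forall>x\<in>V. gdom G x \<in> Z \<longrightarrow> x \<in> units G))" (is "?l \<longleftrightarrow> ?r")
proof -
  let ?H = "{x \<in> arrows G. gdom G x \<in> Z \<and> c x = 0}"
  let ?T = "subtopology (gtop G) ?H"
  let ?I = "{x \<in> arrows G. gdom G x \<in> Z \<and> c x = 0 \<and> gran G x = gdom G x}"
  have eff: "?l \<longleftrightarrow> ?T interior_of ?I = Z"
    unfolding effective_def gtop_kernel_reduction Iso_kernel_reduction[OF c Z]
    by (simp only: units_kernel_reduction[OF c Z])
  have ZH: "Z \<subseteq> ?H" "Z \<subseteq> ?I" using Z grading_unit[OF c] units_iff unit_ran by auto
  \<comment> \<open>\<open>Z\<close> is the trace of the open unit space, so it always lies in the
    interior of the isotropy; only the other inclusion carries content.\<close>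
  have Zopen: "openin ?T Z"
    unfolding openin_subtopology
    using ZH Z units_iff by (intro exI[of _ "units G"]) (auto simp: openin_units)
  show ?thesis
  proof
    assume l: ?l
    show ?r
    proof safe
      fix V x
      assume V: "openin (gtop G) V" "\<forall>x\<in>V. c x = 0" "\<forall>x\<in>V. gdom G x \<in> Z \<longrightarrow> gran G x = gdom G x"
        and x: "x \<in> V" "gdom G x \<in> Z"
      have VA: "V \<subseteq> arrows G" using openin_subset[OF V(1)] by (simp add: arrows_def)
      have "openin ?T (V \<inter> ?H)" using V(1) by (auto simp: openin_subtopology)
      moreover have "V \<inter> ?H \<subseteq> ?I" using V by auto
      ultimately have "V \<inter> ?H \<subseteq> ?T interior_of ?I" by (rule interior_of_maximal[rotated])
      then have "V \<inter> ?H \<subseteq> Z" unfolding l[unfolded eff] .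
      then show "x \<in> units G" using x V VA Z by auto
    qed
  next
    assume r: ?r
    have "?T interior_of ?I \<subseteq> Z"
    proof
      fix x assume x: "x \<in> ?T interior_of ?I"
      then obtain T where T: "openin ?T T" "x \<in> T" "T \<subseteq> ?I" by (auto simp: interior_of_def)
      then obtain V where V: "openin (gtop G) V" "T = V \<inter> ?H" by (auto simp: openin_subtopology)
      let ?V = "V \<inter> {x \<in> arrows G. c x = 0}"
      have "openin (gtop G) ?V" using V openin_grading_fibre[OF c] by blast
      moreover have "\<forall>x\<in>?V. gdom G x \<in> Z \<longrightarrow> gran G x = gdom G x" using T V by blast
      ultimately have "x \<in> units G" using r[rule_format, of ?V x] T V by blast
      then show "x \<in> Z" using T units_iff[of x] by auto
    qed
    moreover have "Z \<subseteq> ?T interior_of ?I" using Zopen ZH(2) by (rule interior_of_maximal[rotated])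
    ultimately show ?l using eff by blast
  qed
qed

section \<open>Annihilator elements over the closure of \<open>W\<close>\<close>

lemma compact_open_bisection_dom_image:
  assumes B: "compact_open_bisection G B"
  shows "compact_open_bisection G (gdom G ` B)"
proof -
  have u: "gdom G ` B \<subseteq> units G" using compact_open_bisection_subset[OF B] by auto
  \<comment> \<open>Both maps fix every unit.\<close>
  have "inj_on (gdom G) (units G)" "inj_on (gran G) (units G)"
    by (auto simp: inj_on_def units_iff unit_ran)
  then have "inj_on (gdom G) (gdom G ` B)" "inj_on (gran G) (gdom G ` B)"
    using u inj_on_subset by blast+
  moreover have "compactin (gtop G) (gdom G ` B)" "openin (gtop G) (gdom G ` B)"
    using B image_compactin[OF _ continuous_dom] open_image_dom
    by (auto simp: compact_open_bisection_iff)
  ultimately show ?thesis by (simp add: compact_open_bisection_iff)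
qed

text \<open>By linearity the basis elements \<open>indicator {w}\<close> suffice, and the
  coefficient at \<open>v\<close> of the action of \<open>f\<close> on one of them is the sum of
  \<open>f\<close> over the arrows from \<open>w\<close> to \<open>v\<close>.\<close>

lemma annihilator_iff:
  assumes "invariant G W"
  shows "f \<in> annihilator G W \<longleftrightarrow> f \<in> steinberg G \<and>
    (\<forall>w\<in>W. \<forall>v. Sum_any (\<lambda>x. if gdom G x = w \<and> gran G x = v then f x else 0) = 0)"
    (is "_ \<longleftrightarrow> _ \<and> ?S")
proof -
  note act = is_steinberg_action_steinberg_action[OF assms]
  have basis: "steinberg_action G W f (indicator {w}) =
      (\<lambda>v. Sum_any (\<lambda>x. if gdom G x = w \<and> gran G x = v then f x else 0))"
    if "f \<in> steinberg G" "w \<in> W" for w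
  proof -
    have "(if gran G x = v then f x * indicator {w} (gdom G x) else 0) =
      (if gdom G x = w \<and> gran G x = v then f x else 0)" for x v
      by auto
    then show ?thesis
      using steinberg_action_eq[OF assms that(1) free_module_on_basis[OF that(2)]]
      by (simp only: action_formula_def)
  qed
  have "steinberg_action G W f m = 0"
    if f: "f \<in> steinberg G" and S: ?S and m: "m \<in> free_module_on W" for m
    using m
  proof (induction rule: free_module_on_induct)
    case zero
    show ?case using is_steinberg_action_zero(2)[OF act f free_module_on_zero] .
  next
    case (add a u n)
    note u = free_module_on_basis[OF add(1)]
    have "steinberg_action G W f (indicator {u}) = 0"
      using basis[OF f add(1)] S add(1) by (auto simp: fun_eq_iff)
    moreover have "fscale a 0 = (0 :: 'a \<Rightarrow> 'b)" by (simp add: fscale_def fun_eq_iff)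
    ultimately show ?case
      by (simp only: is_steinberg_action_add_right[OF act f free_module_on_scale[OF u] add(2)]
          is_steinberg_action_scale_right[OF act f u] add(3) add_0)
  qed
  moreover have ?S if "f \<in> annihilator G W"
  proof (intro ballI allI)
    fix w v assume w: "w \<in> W"
    have "steinberg_action G W f (indicator {w}) = 0"
      using that free_module_on_basis[OF w] unfolding annihilator_def by blast
    then have "steinberg_action G W f (indicator {w}) v = 0" by simp
    then show "Sum_any (\<lambda>x. if gdom G x = w \<and> gran G x = v then f x else 0) = 0"
      using basis[OF _ w] that by (simp add: annihilator_def)
  qed
  ultimately show ?thesis by (auto simp: annihilator_def)
qed

text \<open>Arrows with source in \<open>W\<close> have their source outside \<open>U\<close>, where
  \<open>f\<close> vanishes, so every coefficient sum is zero term by term.\<close>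

lemma steinberg_reduction_subset_annihilator:
  assumes "invariant G W" "invariant G U" "openin (gtop G) U" "U \<inter> W = {}"
  shows "steinberg (reduction G U) \<subseteq> annihilator G W"
proof
  fix f assume f: "f \<in> steinberg (reduction G U)"
  have "(if gdom G x = w \<and> gran G x = v then f x else 0) = 0" if "w \<in> W" for x w v
    using f that assms(4) by (auto simp: steinberg_reduction_iff[OF assms(2,3)])
  then show "f \<in> annihilator G W"
    using f by (simp add: annihilator_iff[OF assms(1)] steinberg_reduction_iff[OF assms(2,3)])
qed

(* If every point of V in W carried an arrow of C - B parallel to B, then B\<inverse>(C - B) would contain
   an open set of isotropy over the closure of W, consisting of units by effectiveness; so some
   point carries none, and this persists in a neighbourhood. *)
lemma shrink_avoiding_parallel:
  assumes c: "grading G c" and W: "W \<subseteq> units G" "aperiodic G c W"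
    and eff: "effective (grading_kernel (reduction G (unit_top G closure_of W)) c)"
    and B: "compact_open_bisection G B" and C: "compact_open_bisection G C"
    and V: "openin (gtop G) V" "V \<subseteq> gdom G ` B" "V \<inter> W \<noteq> {}"
  shows "\<exists>V'. openin (gtop G) V' \<and> V' \<subseteq> V \<and> V' \<inter> W \<noteq> {} \<and>
    (\<forall>b\<in>B. \<forall>x\<in>C. gdom G b \<in> V' \<longrightarrow> gdom G x = gdom G b \<longrightarrow> gran G x = gran G b \<longrightarrow> x \<in> B)"
proof -
  let ?Z = "unit_top G closure_of W"
  note injB = inj_onD[OF compact_open_bisection_inj_on[OF B]]
    and injC = inj_onD[OF compact_open_bisection_inj_on[OF C]]
  have injBr: "b = b'" if "gran G b = gran G b'" "b \<in> B" "b' \<in> B" for b b'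
    using B that by (auto simp: compact_open_bisection_iff dest: inj_onD)
  have BA: "B \<subseteq> arrows G" and CA: "C \<subseteq> arrows G"
    using B C compact_open_bisection_subset by auto
  have Bo: "openin (gtop G) B" and Co: "openin (gtop G) C"
    using B C by (auto simp: compact_open_bisection_iff)
  have ZU: "?Z \<subseteq> units G" using closure_of_subset_topspace[of "unit_top G" W] by simp
  have WZ: "W \<subseteq> ?Z" using closure_of_subset[of W "unit_top G"] W by simp
  have "\<exists>w b. w \<in> V \<inter> W \<and> b \<in> B \<and> gdom G b = w \<and> (\<forall>x\<in>C - B. gdom G x = w \<longrightarrow> gran G x \<noteq> gran G b)"
  proof (rule ccontr)
    assume "\<nexists>w b. w \<in> V \<inter> W \<and> b \<in> B \<and> gdom G b = w \<and> (\<forall>x\<in>C - B. gdom G x = w \<longrightarrow> gran G x \<noteq> gran G b)"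
    then have all: "\<exists>x\<in>C - B. gdom G x = gdom G b \<and> gran G x = gran G b"
      if "b \<in> B" "gdom G b \<in> V \<inter> W" for b
      using that by blast
    from V obtain b0 where b0: "b0 \<in> B" "gdom G b0 \<in> V \<inter> W" by blast
    from all[OF b0] obtain x0 where x0: "x0 \<in> C - B" "gdom G x0 = gdom G b0" "gran G x0 = gran G b0"
      by blast
    have b0A: "b0 \<in> arrows G" and x0A: "x0 \<in> arrows G" using b0 x0 BA CA by auto
    \<comment> \<open>The quotient of two parallel arrows, an isotropy element at the source of
      \<open>b0\<close>. That source lies in \<open>W\<close>, so aperiodicity gives
      \<open>h0\<close> degree zero.\<close>
    define h0 where "h0 = gmult G (ginv G b0) x0"
    have comp: "(ginv G b0, x0) \<in> composable G"
      using b0A x0A x0 by (simp add: composable_def inv_closed dom_inv)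
    have h0A: "h0 \<in> arrows G" and h0d: "gdom G h0 = gdom G b0" and h0r: "gran G h0 = gdom G b0"
      unfolding h0_def using mult_closed[OF comp] dom_mult[OF comp] ran_mult[OF comp] b0A x0
      by (auto simp: ran_inv)
    have comp0: "(b0, h0) \<in> composable G" using b0A h0A h0r by (simp add: composable_def)
    have "(b0, ginv G b0) \<in> composable G" using b0A by (simp add: composable_def inv_closed ran_inv)
    from assoc[OF this comp] have bh: "gmult G b0 h0 = x0"
      using ran_mult_self[OF x0A] x0 by (simp add: h0_def gran_def)
    have "c h0 = 0"
    proof -
      have "h0 \<in> Iso G (gdom G b0)" using h0A h0d h0r by (simp add: Iso_def)
      then show ?thesis using W(2) b0 by (auto simp: aperiodic_def aperiodic_unit_def)
    qed
    have CB: "openin (gtop G) (C - B)"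
      using Co closedin_compact_open_bisection[OF B] by (rule openin_diff)
    \<comment> \<open>Continuity of the multiplication at \<open>(b0, h0)\<close>, whose product
      \<open>x0\<close> lies in the open set \<open>C - B\<close>: it yields neighbourhoods
      \<open>P\<close> of \<open>b0\<close> and \<open>Q\<close> of \<open>h0\<close> whose
      composable products stay in \<open>C - B\<close>.\<close>
    have "openin (subtopology (prod_topology (gtop G) (gtop G)) (composable G))
        {p \<in> topspace (subtopology (prod_topology (gtop G) (gtop G)) (composable G)).
          (case p of (x, y) \<Rightarrow> gmult G x y) \<in> C - B}"
      by (rule openin_continuous_map_preimage[OF continuous_mult CB])
    then obtain N where N: "openin (prod_topology (gtop G) (gtop G)) N"
      "{p \<in> topspace (subtopology (prod_topology (gtop G) (gtop G)) (composable G)).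
          (case p of (x, y) \<Rightarrow> gmult G x y) \<in> C - B} = N \<inter> composable G"
      unfolding openin_subtopology by blast
    have "(b0, h0) \<in> {p \<in> topspace (subtopology (prod_topology (gtop G) (gtop G)) (composable G)).
          (case p of (x, y) \<Rightarrow> gmult G x y) \<in> C - B}"
      using comp0 bh x0 b0A h0A by (simp add: arrows_def)
    then have "(b0, h0) \<in> N" unfolding N(2) by (rule IntD1)
    then obtain P Q where PQ: "openin (gtop G) P" "openin (gtop G) Q" "b0 \<in> P" "h0 \<in> Q" "P \<times> Q \<subseteq> N"
      using N(1)[unfolded openin_prod_topology_alt, rule_format, of b0 h0] by blast
    have PQ': "gmult G b h \<in> C - B" if "b \<in> P" "h \<in> Q" "(b, h) \<in> composable G" for b h
    proof -
      have "(b, h) \<in> N \<inter> composable G" using that PQ by auto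
      then show ?thesis unfolding N(2)[symmetric] by simp
    qed
    \<comment> \<open>The range condition supplies for each \<open>h\<close> some \<open>b\<close>
      in \<open>P \<inter> B\<close> composable with it, the source condition makes
      \<open>all\<close> available over \<open>W\<close>, and degree zero is what the effectiveness
      criterion asks for.\<close>
    define E where "E = Q \<inter> {h \<in> arrows G. gran G h \<in> gdom G ` (P \<inter> B)} \<inter> {h \<in> arrows G. gdom G h \<in> V}
      \<inter> {h \<in> arrows G. c h = 0}"
    have Eo: "openin (gtop G) E"
      unfolding E_def using PQ Bo V
      by (intro openin_Int openin_ran_preimage openin_dom_preimage open_image_dom openin_grading_fibre[OF c])
    \<comment> \<open>The product of \<open>b\<close> and \<open>h\<close> and the arrow
      \<open>x'\<close> parallel to \<open>b'\<close> lie in \<open>C\<close> and have the same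
      source, so they coincide. Then \<open>b\<close> and \<open>b'\<close> have equal ranges, hence
      are equal, and the range of \<open>h\<close> is its source.\<close>
    have iso: "gran G h = gdom G h" if h: "h \<in> E" "gdom G h \<in> W" for h
    proof -
      from h obtain b where b: "b \<in> P" "b \<in> B" "gran G h = gdom G b" by (auto simp: E_def)
      have hA: "h \<in> arrows G" and hV: "gdom G h \<in> V" and hQ: "h \<in> Q" using h by (auto simp: E_def)
      have bhc: "(b, h) \<in> composable G" using b hA BA by (auto simp: composable_def)
      have x: "gmult G b h \<in> C - B" by (rule PQ'[OF b(1) hQ bhc])
      from hV V(2) obtain b' where b': "b' \<in> B" "gdom G h = gdom G b'" by blast
      with all[of b'] h hV obtain x' where x': "x' \<in> C - B" "gdom G x' = gdom G b'" "gran G x' = gran G b'"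
        by auto
      have "x' = gmult G b h" using injC[of x' "gmult G b h"] x x' b' dom_mult[OF bhc] by auto
      then have "gran G b' = gran G b" using x' ran_mult[OF bhc] by simp
      then have "b' = b" using injBr b b' by blast
      then show ?thesis using b b' by simp
    qed
    \<comment> \<open>The non-isotropic arrows of \<open>E\<close> form an open set, and so do their
      sources. An open set of units meeting the closure of \<open>W\<close> meets \<open>W\<close>,
      where \<open>iso\<close> excludes such arrows.\<close>
    have isoZ: "gran G h = gdom G h" if h: "h \<in> E" "gdom G h \<in> ?Z" for h
    proof (rule ccontr)
      assume ne: "gran G h \<noteq> gdom G h"
      let ?E = "E \<inter> {x \<in> arrows G. gdom G x \<noteq> gran G x}"
      have "openin (unit_top G) (gdom G ` ?E)"
        using open_map_dom Eo openin_dom_neq_ran by (auto simp: open_map_def)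
      moreover have "gdom G h \<in> gdom G ` ?E \<inter> ?Z" using h ne by (auto simp: E_def)
      ultimately have "gdom G ` ?E \<inter> W \<noteq> {}" using openin_Int_closure_of_eq_empty by blast
      then obtain k where "k \<in> ?E" "gdom G k \<in> W" by auto
      then show False using iso[of k] by auto
    qed
    have "h0 \<in> E" using PQ h0A h0d h0r b0 \<open>c h0 = 0\<close> by (auto simp: E_def)
    have "h0 \<in> units G"
    proof -
      have "\<forall>x\<in>E. c x = 0" by (auto simp: E_def)
      moreover have "gdom G h0 \<in> ?Z" using h0d b0 WZ by auto
      ultimately show ?thesis
        using eff[unfolded effective_kernel_reduction_iff[OF c ZU], rule_format, of E h0]
          Eo isoZ \<open>h0 \<in> E\<close> by auto
    qed
    \<comment> \<open>A trivial quotient means \<open>x0 = b0\<close>, but \<open>x0\<close> was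
      taken outside \<open>B\<close>.\<close>
    then have "h0 = gdom G b0" using h0d units_iff by simp
    then have "x0 = b0" using bh mult_dom[OF b0A] by simp
    then show False using x0 b0 by simp
  qed
  then obtain w b where wb: "w \<in> V" "w \<in> W" "b \<in> B" "gdom G b = w"
    and no: "\<And>x. x \<in> C - B \<Longrightarrow> gdom G x = w \<Longrightarrow> gran G x \<noteq> gran G b"
    by blast
  \<comment> \<open>An arrow of \<open>C\<close> with source \<open>w\<close> does not exist, or
    lies in \<open>B\<close>, or has a range different from that of \<open>b\<close>. Each
    alternative persists on a neighbourhood of \<open>w\<close>, which yields the new open
    set.\<close>
  consider (off) "w \<notin> gdom G ` C" | (common) x where "x \<in> C \<inter> B" "gdom G x = w"
    | (apart) x where "x \<in> C" "gdom G x = w" "gran G x \<noteq> gran G b"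
    using no by blast
  then show ?thesis
  proof cases
    case off
    have "closedin (gtop G) (gdom G ` C)"
      using closedin_compact_open_bisection[OF compact_open_bisection_dom_image[OF C]] .
    then have "openin (gtop G) (V - gdom G ` C)" using V by blast
    moreover have "\<forall>b\<in>B. \<forall>x\<in>C. gdom G b \<in> V - gdom G ` C \<longrightarrow> gdom G x = gdom G b \<longrightarrow> gran G x = gran G b \<longrightarrow> x \<in> B"
      by (metis DiffD2 imageI)
    ultimately show ?thesis using wb off by (intro exI[of _ "V - gdom G ` C"]) blast
  next
    case common
    let ?V = "V \<inter> gdom G ` (C \<inter> B)"
    have "openin (gtop G) ?V" using V Co Bo open_image_dom by blast
    moreover have "x \<in> B" if "x \<in> C" "gdom G x \<in> ?V" for x
      using that injC by blast
    moreover have "w \<in> ?V" using common wb by auto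
    ultimately show ?thesis using wb by (intro exI[of _ ?V]) auto
  next
    case apart
    have "gran G x \<in> topspace (gtop G)" "gran G b \<in> topspace (gtop G)"
      using apart wb CA BA ran_arrow unfolding arrows_def[symmetric] by auto
    then obtain P Q where PQ: "openin (gtop G) P" "openin (gtop G) Q" "gran G x \<in> P" "gran G b \<in> Q"
      "disjnt P Q"
      using hausdorff apart(3) unfolding Hausdorff_space_def by blast
    \<comment> \<open>Cutting \<open>C\<close> and \<open>B\<close> by disjoint neighbourhoods of
      the two ranges keeps their arrows over \<open>?V\<close> from being parallel, because each
      bisection has only one arrow over a given source.\<close>
    let ?C = "C \<inter> {x \<in> arrows G. gran G x \<in> P}" and ?B = "B \<inter> {x \<in> arrows G. gran G x \<in> Q}"
    let ?V = "V \<inter> gdom G ` ?C \<inter> gdom G ` ?B"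
    have "openin (gtop G) ?V"
      using V Co Bo PQ by (intro openin_Int open_image_dom openin_ran_preimage)
    moreover have "w \<in> ?V"
    proof -
      have "x \<in> ?C" "b \<in> ?B" using apart wb PQ CA BA by auto
      from this[THEN imageI, of "gdom G"] show ?thesis using apart wb by simp
    qed
    moreover have "gran G y \<noteq> gran G b'"
      if "b' \<in> B" "y \<in> C" "gdom G b' \<in> ?V" "gdom G y = gdom G b'" for b' y
    proof -
      have "gdom G b' \<in> gdom G ` ?B" "gdom G b' \<in> gdom G ` ?C" using that(3) by blast+
      then obtain b1 y1 where "b1 \<in> ?B" "gdom G b' = gdom G b1" "y1 \<in> ?C" "gdom G b' = gdom G y1"
        by (elim imageE) iprover
      then have "b' \<in> ?B" "y \<in> ?C"
        using injB[of b' b1] injC[of y y1] that by auto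
      then show ?thesis using PQ(5) by (auto simp: disjnt_iff)
    qed
    ultimately show ?thesis using wb by (intro exI[of _ ?V]) blast
  qed
qed

text \<open>The avoidance property survives shrinking the open set, so the bisections are treated in
  succession, each inside the set obtained before.\<close>

lemma shrink_avoiding_parallel_finite:
  assumes c: "grading G c" and W: "W \<subseteq> units G" "aperiodic G c W"
    and eff: "effective (grading_kernel (reduction G (unit_top G closure_of W)) c)"
    and B: "compact_open_bisection G B" and "finite \<C>" "\<forall>C\<in>\<C>. compact_open_bisection G C"
    and V: "openin (gtop G) V" "V \<subseteq> gdom G ` B" "V \<inter> W \<noteq> {}"
  shows "\<exists>V'. openin (gtop G) V' \<and> V' \<subseteq> V \<and> V' \<inter> W \<noteq> {} \<and>
    (\<forall>b\<in>B. \<forall>x\<in>\<Union>\<C>. gdom G b \<in> V' \<longrightarrow> gdom G x = gdom G b \<longrightarrow> gran G x = gran G b \<longrightarrow> x \<in> B)"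
  using assms(6,7)
proof (induction rule: finite_induct)
  case empty
  then show ?case using V by (intro exI[of _ V]) auto
next
  case (insert C \<C>)
  then obtain V1 where V1: "openin (gtop G) V1" "V1 \<subseteq> V" "V1 \<inter> W \<noteq> {}"
    "\<forall>b\<in>B. \<forall>x\<in>\<Union>\<C>. gdom G b \<in> V1 \<longrightarrow> gdom G x = gdom G b \<longrightarrow> gran G x = gran G b \<longrightarrow> x \<in> B"
    by auto
  have C: "compact_open_bisection G C" and "V1 \<subseteq> gdom G ` B" using insert V1 V by auto
  from shrink_avoiding_parallel[OF c W eff B C V1(1) this(2) V1(3)] obtain V2 where
    V2: "openin (gtop G) V2" "V2 \<subseteq> V1" "V2 \<inter> W \<noteq> {}"
    "\<forall>b\<in>B. \<forall>x\<in>C. gdom G b \<in> V2 \<longrightarrow> gdom G x = gdom G b \<longrightarrow> gran G x = gran G b \<longrightarrow> x \<in> B"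
    by blast
  show ?case
  proof (intro exI[of _ V2] conjI ballI impI)
    show "openin (gtop G) V2" "V2 \<subseteq> V" "V2 \<inter> W \<noteq> {}" using V1(2) V2(1-3) by blast+
    fix b x assume "b \<in> B" "x \<in> \<Union> (insert C \<C>)" "gdom G b \<in> V2"
      "gdom G x = gdom G b" "gran G x = gran G b"
    then show "x \<in> B" using V1(4) V2(2,4) by blast
  qed
qed

lemma annihilator_vanishes_on_closure:
  assumes c: "grading G c" and W: "invariant G W" "aperiodic G c W"
    and eff: "effective (grading_kernel (reduction G (unit_top G closure_of W)) c)"
    and f: "f \<in> annihilator G W" and x: "gdom G x \<in> unit_top G closure_of W"
  shows "f x = 0"
proof (rule ccontr)
  assume fx: "f x \<noteq> 0"
  have WU: "W \<subseteq> units G" using W by (simp add: invariant_def)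
  have fS: "f \<in> steinberg G" using f by (simp add: annihilator_def)
  have "x \<in> arrows G" using fx steinberg_zero_off[OF fS] by blast
  from steinberg_locally_constant[OF fS this] obtain N where
    N: "openin (gtop G) N" "x \<in> N" "\<forall>y\<in>N. f y = f x" by blast
  from bisection_basis[OF N(1,2)] obtain B where
    B: "compact_open_bisection G B" "x \<in> B" "B \<subseteq> N" by blast
  obtain \<C> where C: "finite \<C>" "\<forall>C\<in>\<C>. compact_open_bisection G C" "{x. f x \<noteq> 0} \<subseteq> \<Union>\<C>"
    using steinberg_support_cover[OF fS] by blast
  have "openin (gtop G) (gdom G ` B)" "openin (unit_top G) (gdom G ` B)"
    using B open_map_dom open_image_dom by (auto simp: compact_open_bisection_iff open_map_def)
  moreover have "gdom G ` B \<inter> unit_top G closure_of W \<noteq> {}" using B x by blast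
  ultimately have "openin (gtop G) (gdom G ` B)" "gdom G ` B \<inter> W \<noteq> {}"
    using openin_Int_closure_of_eq_empty by blast+
  from shrink_avoiding_parallel_finite[OF c WU W(2) eff B(1) C(1,2) this(1) subset_refl this(2)]
  obtain V where V: "V \<subseteq> gdom G ` B" "V \<inter> W \<noteq> {}"
    "\<forall>b\<in>B. \<forall>y\<in>\<Union>\<C>. gdom G b \<in> V \<longrightarrow> gdom G y = gdom G b \<longrightarrow> gran G y = gran G b \<longrightarrow> y \<in> B"
    by blast
  then obtain b where b: "b \<in> B" "gdom G b \<in> V" "gdom G b \<in> W" by blast
  \<comment> \<open>A parallel arrow \<open>y\<close> of the support lies in the cover, hence in
    \<open>B\<close> by the choice of \<open>V\<close>, hence equals \<open>b\<close>. The
    coefficient sum is thus the single term \<open>f b\<close>, and \<open>f\<close> is constant on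
    \<open>N\<close>, which contains \<open>b\<close> and \<open>x\<close>.\<close>
  have "(if gdom G y = gdom G b \<and> gran G y = gran G b then f y else 0) = (if y = b then f b else 0)"
    for y
    using V(3) b C(3) inj_onD[OF compact_open_bisection_inj_on[OF B(1)], of y b] by auto
  then have "Sum_any (\<lambda>y. if gdom G y = gdom G b \<and> gran G y = gran G b then f y else 0) = f b"
    by (simp only:) simp
  moreover have "f b = f x" using b B N by blast
  ultimately show False using f b fx by (auto simp: annihilator_iff[OF W(1)])
qed

section \<open>From the annihilator back to effectiveness\<close>

lemma effective_if_annihilator:
  assumes c: "grading G c" and W: "invariant G W"
    and ann: "\<And>(f :: 'a \<Rightarrow> 'r::comm_ring_1) x. f \<in> annihilator G W \<Longrightarrow>
      gdom G x \<in> unit_top G closure_of W \<Longrightarrow> f x = 0"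
  shows "effective (grading_kernel (reduction G (unit_top G closure_of W)) c)"
proof -
  let ?Z = "unit_top G closure_of W"
  have WU: "W \<subseteq> units G" using W by (simp add: invariant_def)
  have ZU: "?Z \<subseteq> units G" using closure_of_subset_topspace[of "unit_top G" W] by simp
  have WZ: "W \<subseteq> ?Z" using closure_of_subset[of W "unit_top G"] WU by simp
  show ?thesis
    unfolding effective_kernel_reduction_iff[OF c ZU]
  proof safe
    fix V x
    assume V: "openin (gtop G) V" "\<forall>x\<in>V. gdom G x \<in> ?Z \<longrightarrow> gran G x = gdom G x"
      and x: "x \<in> V" "gdom G x \<in> ?Z"
    show "x \<in> units G"
    proof (rule ccontr)
      assume "x \<notin> units G"
      then obtain B where B: "compact_open_bisection G B" "x \<in> B" "B \<subseteq> V - units G"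
        using bisection_basis[of "V - units G" x] V(1) x closedin_units by blast
      note dB = compact_open_bisection_dom_image[OF B(1)]
      have BA: "B \<subseteq> arrows G" using compact_open_bisection_subset[OF B(1)] .
      \<comment> \<open>Over \<open>W\<close> every arrow of \<open>B\<close> is parallel to the
        unit at its source, so the contributions of \<open>B\<close> and d(B) cancel.\<close>
      define f :: "'a \<Rightarrow> 'r" where
        "f = indicator B + fscale (- 1) (indicator (gdom G ` B))"
      have "f \<in> steinberg G"
        unfolding f_def using B dB by (intro steinberg_add steinberg_scale steinberg_indicator)
      moreover have "Sum_any (\<lambda>y. if gdom G y = w \<and> gran G y = v then f y else 0) = 0"
        if w: "w \<in> W" for w v
      proof (cases "w \<in> gdom G ` B")
        case False
        have "(if gdom G y = w \<and> gran G y = v then f y else 0) = 0" for y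
        proof -
          have "gdom G y = y" if "y \<in> gdom G ` B" using that BA by auto
          then show ?thesis using False by (auto simp: f_def fscale_def indicator_def)
        qed
        then show ?thesis by simp
      next
        case True
        then obtain b where b: "b \<in> B" "w = gdom G b" by blast
        have rb: "gran G b = w" using V(2) b B w WZ by auto
        have wu: "w \<in> units G" "gdom G w = w" "gran G w = w"
          using w WU units_iff unit_ran by auto
        have inj: "y = b" if "y \<in> B" "gdom G y = w" for y
          using inj_onD[OF compact_open_bisection_inj_on[OF B(1)]] that b by blast
        have inj': "y = w" if "y \<in> gdom G ` B" "gdom G y = w" for y
          using that BA by auto
        let ?k = "if v = w then 1 else (0::'r)"
        \<comment> \<open>Over \<open>w\<close> the function is supported on the two arrows
          \<open>b\<close> and \<open>w\<close>, which are distinct since \<open>B\<close> contains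
          no unit.\<close>
        have "(if gdom G y = w \<and> gran G y = v then f y else 0) =
            (if y = b then ?k else 0) + (if y = w then - ?k else 0)" for y
        proof -
          have "b \<notin> gdom G ` B" using B b BA dom_unit by blast
          moreover have "w \<notin> B" using B wu by blast
          ultimately have "f b = 1" "f w = - 1" "b \<noteq> w"
            using b(1) True by (auto simp: f_def fscale_def)
          moreover have "f y = 0" if "y \<noteq> b" "y \<noteq> w" "gdom G y = w"
          proof -
            have "y \<notin> B" "y \<notin> gdom G ` B" using that inj inj' by blast+
            then show ?thesis by (simp add: f_def fscale_def)
          qed
          moreover have "gdom G b = w" using b(2) by simp
          ultimately show ?thesis
            using rb wu(2,3) by (cases "y = b"; cases "y = w"; cases "v = w") auto
        qed
        moreover have "Sum_any (\<lambda>y. (if y = b then ?k else 0) + (if y = w then - ?k else 0)) =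
            Sum_any (\<lambda>y. if y = b then ?k else 0) + Sum_any (\<lambda>y. if y = w then - ?k else 0)"
          by (rule Sum_any.distrib; rule finite_subset[of _ "{b, w}"]; auto)
        ultimately show ?thesis by simp
      qed
      ultimately have "f \<in> annihilator G W" by (simp add: annihilator_iff[OF W])
      then have "f x = 0" using ann x by blast
      \<comment> \<open>As \<open>x\<close> is in \<open>B\<close> and not a unit,
        \<open>f x\<close> is 1, which is nonzero in the ring.\<close>
      moreover have "x \<notin> gdom G ` B" using B BA dom_unit by blast
      ultimately show False using B by (simp add: f_def fscale_def)
    qed
  qed
qed

end

section \<open>The two conditions compared for each \<open>W\<close>\<close>

theorem theorem7p11:
  fixes G :: "'g tgroupoid" and c :: "'g \<Rightarrow> 'c::group_add"
  assumes "ample_groupoid G" and "Hausdorff_space (gtop G)" and "grading G c"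
  shows "(\<forall>W. invariant G W \<and> aperiodic G c W \<longrightarrow>
            effective (grading_kernel (reduction G (unit_top G closure_of W)) c)) \<longleftrightarrow>
         (\<forall>W. invariant G W \<and> aperiodic G c W \<longrightarrow>
            (annihilator G W :: ('g \<Rightarrow> 'r::comm_ring_1) set) =
            steinberg (reduction G (unit_top G interior_of (units G - W))))"
proof -
  interpret hausdorff_ample_groupoid G
    using assms(1,2) by (simp add: hausdorff_ample_groupoid_def hausdorff_ample_groupoid_axioms_def)
  have "effective (grading_kernel (reduction G (unit_top G closure_of W)) c) \<longleftrightarrow>
      (annihilator G W :: ('g \<Rightarrow> 'r) set) =
        steinberg (reduction G (unit_top G interior_of (units G - W)))"
    if W: "invariant G W" "aperiodic G c W" for W
  proof -
    let ?Z = "unit_top G closure_of W" and ?U = "unit_top G interior_of (units G - W)"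
    have "invariant G (units G - W)"
      using invariant_ran_iff[OF W(1)] by (auto simp: invariant_def)
    then have inv: "invariant G ?U" by (rule invariant_interior_of)
    have op: "openin (gtop G) ?U" using openin_interior_of openin_unit_top_iff by blast
    \<comment> \<open>With this, membership of an element of \<open>steinberg G\<close> in the
      algebra over \<open>?U\<close> becomes vanishing at all arrows whose source lies in
      \<open>?Z\<close>.\<close>
    have UZ: "?U = units G - ?Z" using interior_of_complement[of "unit_top G" W] by simp
    have disj: "?U \<inter> W = {}" using interior_of_subset[of "unit_top G" "units G - W"] by blast
    show ?thesis
    proof
      assume eff: "effective (grading_kernel (reduction G ?Z) c)"
      have "f \<in> steinberg (reduction G ?U)" if f: "f \<in> annihilator G W" for f :: "'g \<Rightarrow> 'r"
      proof -
        have fS: "f \<in> steinberg G" using f by (simp add: annihilator_def)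
        have "gdom G x \<in> ?U" if "f x \<noteq> 0" for x
        proof -
          have "x \<in> arrows G" using that steinberg_zero_off[OF fS] by blast
          then have "gdom G x \<in> units G" by (rule dom_unit)
          then show ?thesis
            using that UZ annihilator_vanishes_on_closure[OF assms(3) W eff f] by blast
        qed
        with fS show ?thesis by (simp add: steinberg_reduction_iff[OF inv op])
      qed
      then show "(annihilator G W :: ('g \<Rightarrow> 'r) set) = steinberg (reduction G ?U)"
        using steinberg_reduction_subset_annihilator[OF W(1) inv op disj] by blast
    next
      assume eq: "(annihilator G W :: ('g \<Rightarrow> 'r) set) = steinberg (reduction G ?U)"
      show "effective (grading_kernel (reduction G ?Z) c)"
      proof (rule effective_if_annihilator[OF assms(3) W(1)])
        fix f :: "'g \<Rightarrow> 'r" and x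
        assume f: "f \<in> annihilator G W" and x: "gdom G x \<in> ?Z"
        then have "f x \<noteq> 0 \<Longrightarrow> gdom G x \<in> ?U"
          unfolding eq steinberg_reduction_iff[OF inv op] by blast
        with x show "f x = 0" unfolding UZ by blast
      qed
    qed
  qed
  then show ?thesis by blast
qed

end
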